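(* Let $n\ge3$, let $\mathcal{M}$ be the Markov operator of the edge lamplighter random walk on the discrete circle $C_n$, let $\Theta$ be a set of representatives for the orbits of $C_n$ on $C_2^n$ such that $\theta(-1)=1$ for every $\theta\in\Theta$ with $\theta\neq\mathbf{0}$, and let $\theta\in\Theta$ have period $t$, with $m=n/t$. Let $0\le r\le m-1$ and let $\phi_{r,0},\phi_{r,1},\dots,\phi_{r,t-1}$ be an orthogonal basis of $\langle f_{r,0},f_{r,1},\dots,f_{r,t-1}\rangle$ consisting of eigenvectors of $M_\theta$. For $j=0,\dots,t-1$ let \[ \mathrm{Ind}_{C_2\wr\langle t\rangle}^{C_2\wr C_n}\langle\tilde\chi_\theta\otimes(\phi_{r,j})^\#\rangle \] denote the subspace of $L(C_2\wr C_n)=L(C_2^n\times C_n)$ spanned by $\chi_{s\theta}\otimes s\phi_{r,j}$, $s=0,1,\dots,t-1$. Then \[ \bigoplus_{j=0}^{t-1}\mathrm{Ind}_{C_2\wr\langle t\rangle}^{C_2\wr C_n}\langle\tilde\chi_\theta\otimes(\phi_{r,j})^\#\rangle \] is a decomposition of the $\mathrm{Ind}_{C_2\wr\langle t\rangle}^{C_2\wr C_n}\big[\tilde\chi_\theta\otimes(e_r|_{\langle t\rangle})^\#\big]$-isotypic component of $L(C_2\wr C_n)$ into eigenspaces of $\mathcal{M}$ (that is, each summand is a $C_2\wr C_n$-subrepresentation on which $\mathcal{M}$ acts as a scalar, and the direct sum is the isotypic component).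
   Context: $C_n=\mathbb{Z}/n\mathbb{Z}$, written additively; $C_2=\{0,1\}$ with addition mod $2$; $C_2^n$ is the group of maps $\theta:C_n\to C_2$ (zero element $\mathbf{0}$), on which $C_n$ acts by $(k\theta)(j)=\theta(j-k)$. $C_2\wr C_n$ is the set $C_2^n\times C_n$ with product $(\theta,k)(\omega,h)=(\theta+k\omega,k+h)$; it acts on itself by left multiplication and on $L(C_2\wr C_n)$ (complex functions, standard scalar product) by $(af)(b)=f(a^{-1}b)$. $C_n$ acts on $L(C_n)$ by $(kf)(j)=f(j-k)$. $\chi_\theta(\omega)=(-1)^{\sum_j\theta(j)\omega(j)}$ and $(F\otimes f)(\omega,x)=F(\omega)f(x)$. The period $t$ of $\theta$ is the smallest positive integer with $\theta(k+t)=\theta(k)$ for all $k$ ($\theta$ viewed as an $n$-periodic function on $\mathbb{Z}$); $t$ divides $n$ and the stabilizer of $\theta$ is the subgroup $\langle t\rangle$ of order $m=n/t$. $e_k(h)=\exp(2\pi i hk/n)$. $\tilde\chi_\theta\otimes(e_r|_{\langle t\rangle})^\#$ is the one-dimensional character $(\omega,lt)\mapsto\chi_\theta(\omega)e_r(lt)$ of $C_2\wr\langle t\rangle=\{(\omega,k)\in C_2\wr C_n:k\in\langle t\rangle\}$. For $0\le s\le t-1$, $\Omega_s=\{s,s+t,\dots,s+(m-1)t\}\subseteq C_n$, and $f_{r,s}\in L(C_n)$ is $f_{r,s}(k)=e_{m-r}(k-s)$ if $k\in\Omega_s$, $0$ otherwise. $\langle v_1,\dots,v_p\rangle$ denotes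 linear span. Lamps are on the edges of the circle: $\theta(k)$ is the value at the edge $\{k,k+1\}$. The edge lamplighter Markov operator is \[ (\mathcal{M}\Phi)(\omega,x)=\tfrac14\big[\Phi(\omega,x+1)+\Phi(\omega+\delta_x,x+1)+\Phi(\omega,x-1)+\Phi(\omega+\delta_{x-1},x-1)\big], \] where $\delta_x\in C_2^n$ equals $1$ at $x$ and $0$ elsewhere; and $M_\theta:L(C_n)\to L(C_n)$ is $(M_\theta f)(x)=\frac{1-\theta(x)}{2}f(x+1)+\frac{1-\theta(x-1)}{2}f(x-1)$. *)

theory Defs
  imports
    Complex_Main
    "HOL-Library.Z2"
    "HOL-Library.Function_Algebras"
    "HOL-Algebra.Group"
    "Berlekamp_Zassenhaus.Finite_Field"
begin

text \<open>
  The cyclic group \<open>C\<^sub>n\<close> is the additive group of the type \<open>'n mod_ring\<close> with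
  \<open>n = CARD('n)\<close>, the group \<open>C\<^sub>2\<close> is the additive group of \<open>bit\<close>, and \<open>C\<^sub>2\<^sup>n\<close> is
  \<open>'n mod_ring \<Rightarrow> bit\<close> with pointwise addition. For a finite set \<open>X\<close> that is a type \<open>'x\<close>,
  \<open>L(X)\<close> is the type \<open>'x \<Rightarrow> complex\<close>.
\<close>

subsection \<open>Complex functions on a finite set\<close>

definition fscale :: "complex \<Rightarrow> ('x \<Rightarrow> complex) \<Rightarrow> 'x \<Rightarrow> complex" where
  "fscale c f = (\<lambda>x. c * f x)"

interpretation cfun: vector_space "fscale :: complex \<Rightarrow> ('x \<Rightarrow> complex) \<Rightarrow> 'x \<Rightarrow> complex"
  by standard (simp_all add: fscale_def fun_eq_iff algebra_simps)

definition scalar_prod :: "('x::finite \<Rightarrow> complex) \<Rightarrow> ('x \<Rightarrow> complex) \<Rightarrow> complex" where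
  "scalar_prod f g = (\<Sum>x\<in>UNIV. f x * cnj (g x))"

definition eigenvector ::
    "(('x \<Rightarrow> complex) \<Rightarrow> ('x \<Rightarrow> complex)) \<Rightarrow> ('x \<Rightarrow> complex) \<Rightarrow> bool" where
  "eigenvector A f \<longleftrightarrow> f \<noteq> 0 \<and> (\<exists>c. A f = fscale c f)"

text \<open>\<open>v\<^sub>0, \<dots>, v\<^sub>p\<^sub>-\<^sub>1\<close> is an orthogonal basis of the subspace \<open>W\<close>.\<close>

definition orthogonal_basis ::
    "(nat \<Rightarrow> ('x::finite \<Rightarrow> complex)) \<Rightarrow> nat \<Rightarrow> ('x \<Rightarrow> complex) set \<Rightarrow> bool" where
  "orthogonal_basis v p W \<longleftrightarrow>
     inj_on v {..<p} \<and> cfun.independent (v ` {..<p}) \<and> cfun.span (v ` {..<p}) = W \<and>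
     (\<forall>i<p. \<forall>j<p. i \<noteq> j \<longrightarrow> scalar_prod (v i) (v j) = 0)"

definition internal_direct_sum ::
    "('i \<Rightarrow> ('x \<Rightarrow> complex) set) \<Rightarrow> 'i set \<Rightarrow> ('x \<Rightarrow> complex) set \<Rightarrow> bool" where
  "internal_direct_sum W I V \<longleftrightarrow>
     V = {\<Sum>i\<in>I. v i | v. \<forall>i\<in>I. v i \<in> W i} \<and>
     (\<forall>v. (\<forall>i\<in>I. v i \<in> W i) \<and> (\<Sum>i\<in>I. v i) = 0 \<longrightarrow> (\<forall>i\<in>I. v i = 0))"

subsection \<open>Subrepresentations of the left regular representation\<close>

text \<open>The definitions of this section are meant for groups \<open>G\<close> with \<open>carrier G = UNIV\<close>.\<close>

definition left_transl :: "('g, 'e) monoid_scheme \<Rightarrow> 'g \<Rightarrow> ('g \<Rightarrow> complex) \<Rightarrow> 'g \<Rightarrow> complex" where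
  "left_transl G a f = (\<lambda>b. f (inv\<^bsub>G\<^esub> a \<otimes>\<^bsub>G\<^esub> b))"

definition subrep :: "('g, 'e) monoid_scheme \<Rightarrow> ('g \<Rightarrow> complex) set \<Rightarrow> bool" where
  "subrep G W \<longleftrightarrow> cfun.subspace W \<and> (\<forall>a\<in>carrier G. \<forall>f\<in>W. left_transl G a f \<in> W)"

definition irreducible_subrep :: "('g, 'e) monoid_scheme \<Rightarrow> ('g \<Rightarrow> complex) set \<Rightarrow> bool" where
  "irreducible_subrep G W \<longleftrightarrow>
     subrep G W \<and> W \<noteq> {0} \<and> (\<forall>U. subrep G U \<and> U \<subseteq> W \<longrightarrow> U = {0} \<or> U = W)"

definition equivalent_subreps ::
    "('g, 'e) monoid_scheme \<Rightarrow> ('g \<Rightarrow> complex) set \<Rightarrow> ('g \<Rightarrow> complex) set \<Rightarrow> bool" where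
  "equivalent_subreps G U W \<longleftrightarrow>
     (\<exists>T. bij_betw T U W \<and>
       (\<forall>f\<in>U. \<forall>g\<in>U. T (f + g) = T f + T g) \<and>
       (\<forall>c. \<forall>f\<in>U. T (fscale c f) = fscale c (T f)) \<and>
       (\<forall>a\<in>carrier G. \<forall>f\<in>U. T (left_transl G a f) = left_transl G a (T f)))"

text \<open>
  The isotypic component in \<open>L(G)\<close> of an irreducible representation, which is given as a
  space \<open>R\<close> of functions on \<open>G\<close> with \<open>G\<close> acting by left translation. If \<open>R\<close> is not
  irreducible, this is \<open>{0}\<close>.
\<close>

definition isotypic_component ::
    "('g, 'e) monoid_scheme \<Rightarrow> ('g \<Rightarrow> complex) set \<Rightarrow> ('g \<Rightarrow> complex) set" where
  "isotypic_component G R =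
     cfun.span (\<Union>{W. irreducible_subrep G W \<and> equivalent_subreps G W R})"

text \<open>
  The representation of \<open>G\<close> induced from the one-dimensional character \<open>\<sigma>\<close> of the subgroup \<open>H\<close>,
  realized as the space of all \<open>F : G \<rightarrow> \<complex>\<close> with \<open>F(gh) = \<sigma>(h\<^sup>-\<^sup>1) F(g)\<close>, on which \<open>G\<close> acts
  by left translation.
\<close>

definition induced_rep ::
    "('g, 'e) monoid_scheme \<Rightarrow> 'g set \<Rightarrow> ('g \<Rightarrow> complex) \<Rightarrow> ('g \<Rightarrow> complex) set" where
  "induced_rep G H \<sigma> =
     {F. \<forall>g\<in>carrier G. \<forall>h\<in>H. F (g \<otimes>\<^bsub>G\<^esub> h) = \<sigma> (inv\<^bsub>G\<^esub> h) * F g}"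

subsection \<open>The cyclic group and its actions\<close>

text \<open>The translation action of \<open>C\<^sub>n\<close>, used both on \<open>C\<^sub>2\<^sup>n\<close> and on \<open>L(C\<^sub>n)\<close>.\<close>

definition shift :: "'n::finite mod_ring \<Rightarrow> ('n mod_ring \<Rightarrow> 'b) \<Rightarrow> 'n mod_ring \<Rightarrow> 'b" where
  "shift k f = (\<lambda>j. f (j - k))"

definition orbit_representatives :: "('n::finite mod_ring \<Rightarrow> bit) set \<Rightarrow> bool" where
  "orbit_representatives \<Theta> \<longleftrightarrow> (\<forall>\<omega>. \<exists>!\<theta>. \<theta> \<in> \<Theta> \<and> (\<exists>k. \<theta> = shift k \<omega>))"

definition period :: "('n::nontriv mod_ring \<Rightarrow> bit) \<Rightarrow> nat" where
  "period \<theta> = (LEAST t. 0 < t \<and> (\<forall>k. \<theta> (k + of_nat t) = \<theta> k))"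

definition cyc_subgroup :: "nat \<Rightarrow> 'n::nontriv mod_ring set" where
  "cyc_subgroup t = {of_nat (l * t) | l. True}"

definition e_char :: "nat \<Rightarrow> 'n::finite mod_ring \<Rightarrow> complex" where
  "e_char k h =
     exp (2 * complex_of_real pi * \<i> * of_int (to_int_mod_ring h) * of_nat k / of_nat CARD('n))"

definition Omega :: "nat \<Rightarrow> nat \<Rightarrow> 'n::nontriv mod_ring set" where
  "Omega t s = {of_nat (s + l * t) | l. l < CARD('n) div t}"

text \<open>The function \<open>f\<^sub>r\<^sub>,\<^sub>s\<close> for the period \<open>t\<close>; here \<open>m = n / t\<close> and \<open>r < m\<close>.\<close>

definition f_fun :: "nat \<Rightarrow> nat \<Rightarrow> nat \<Rightarrow> 'n::nontriv mod_ring \<Rightarrow> complex" where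
  "f_fun t r s k =
     (if k \<in> Omega t s then e_char (CARD('n) div t - r) (k - of_nat s) else 0)"

subsection \<open>The lamplighter group\<close>

definition lamplighter :: "(('n::finite mod_ring \<Rightarrow> bit) \<times> 'n mod_ring) monoid" where
  "lamplighter =
     \<lparr>carrier = UNIV,
      monoid.mult = (\<lambda>(\<theta>, k) (\<omega>, h). (\<theta> + shift k \<omega>, k + h)),
      one = (0, 0)\<rparr>"

lemma group_lamplighter:
  "group (lamplighter :: (('n::finite mod_ring \<Rightarrow> bit) \<times> 'n mod_ring) monoid)"
proof (rule groupI)
  fix x y z :: "('n mod_ring \<Rightarrow> bit) \<times> 'n mod_ring"
  show "x \<otimes>\<^bsub>lamplighter\<^esub> y \<otimes>\<^bsub>lamplighter\<^esub> z = x \<otimes>\<^bsub>lamplighter\<^esub> (y \<otimes>\<^bsub>lamplighter\<^esub> z)"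
    by (cases x; cases y; cases z)
       (simp add: lamplighter_def shift_def fun_eq_iff algebra_simps)
  show "\<one>\<^bsub>lamplighter\<^esub> \<otimes>\<^bsub>lamplighter\<^esub> x = x"
    by (cases x) (simp add: lamplighter_def shift_def fun_eq_iff)
  have "(shift (- snd x) (- fst x), - snd x) \<otimes>\<^bsub>lamplighter\<^esub> x = \<one>\<^bsub>lamplighter\<^esub>"
    by (cases x) (simp add: lamplighter_def shift_def fun_eq_iff)
  moreover have "(shift (- snd x) (- fst x), - snd x) \<in> carrier lamplighter"
    by (simp add: lamplighter_def)
  ultimately show "\<exists>y\<in>carrier lamplighter. y \<otimes>\<^bsub>lamplighter\<^esub> x = \<one>\<^bsub>lamplighter\<^esub>"
    by blast
qed (simp_all add: lamplighter_def)

text \<open>The subgroup \<open>C\<^sub>2 \<wr> \<langle>t\<rangle>\<close>.\<close>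

definition sub_lamplighter :: "nat \<Rightarrow> (('n::nontriv mod_ring \<Rightarrow> bit) \<times> 'n mod_ring) set" where
  "sub_lamplighter t = {(\<omega>, k). k \<in> cyc_subgroup t}"

definition chi :: "('n::finite mod_ring \<Rightarrow> bit) \<Rightarrow> ('n mod_ring \<Rightarrow> bit) \<Rightarrow> complex" where
  "chi \<theta> \<omega> = (-1) ^ (\<Sum>j\<in>UNIV. of_bit (\<theta> j) * of_bit (\<omega> j) :: nat)"

definition tensor :: "('a \<Rightarrow> complex) \<Rightarrow> ('b \<Rightarrow> complex) \<Rightarrow> 'a \<times> 'b \<Rightarrow> complex"
    (infixr "\<otimes>\<^sub>f" 70) where
  "F \<otimes>\<^sub>f f = (\<lambda>(\<omega>, x). F \<omega> * f x)"

text \<open>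
  The spaces \<open>Ind \<langle>\<chi>\<^sub>\<theta> \<otimes> \<phi>\<rangle>\<close>, spanned by the translates \<open>\<chi>\<^sub>s\<^sub>\<theta> \<otimes> s\<phi>\<close> for \<open>0 \<le> s < t\<close>.
\<close>

definition ind_span ::
    "('n::nontriv mod_ring \<Rightarrow> bit) \<Rightarrow> nat \<Rightarrow> ('n mod_ring \<Rightarrow> complex) \<Rightarrow>
     (('n mod_ring \<Rightarrow> bit) \<times> 'n mod_ring \<Rightarrow> complex) set" where
  "ind_span \<theta> t \<phi> =
     cfun.span {chi (shift (of_nat s) \<theta>) \<otimes>\<^sub>f shift (of_nat s) \<phi> | s. s < t}"

subsection \<open>The edge lamplighter random walk\<close>

text \<open>The lamp at \<open>x\<close> sits on the edge \<open>{x, x + 1}\<close>.\<close>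

definition delta :: "'n::finite mod_ring \<Rightarrow> 'n mod_ring \<Rightarrow> bit" where
  "delta x = (\<lambda>j. if j = x then 1 else 0)"

definition edge_markov ::
    "(('n::nontriv mod_ring \<Rightarrow> bit) \<times> 'n mod_ring \<Rightarrow> complex) \<Rightarrow>
     ('n mod_ring \<Rightarrow> bit) \<times> 'n mod_ring \<Rightarrow> complex" where
  "edge_markov \<Phi> = (\<lambda>(\<omega>, x).
     1 / 4 * (\<Phi> (\<omega>, x + 1) + \<Phi> (\<omega> + delta x, x + 1) +
              \<Phi> (\<omega>, x - 1) + \<Phi> (\<omega> + delta (x - 1), x - 1)))"

definition M_op ::
    "('n::nontriv mod_ring \<Rightarrow> bit) \<Rightarrow> ('n mod_ring \<Rightarrow> complex) \<Rightarrow> 'n mod_ring \<Rightarrow> complex" where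
  "M_op \<theta> f = (\<lambda>x. (1 - of_bit (\<theta> x)) / 2 * f (x + 1) +
                   (1 - of_bit (\<theta> (x - 1))) / 2 * f (x - 1))"

end

(* A vector of L(G) on which the subgroup H acts through the inducing character has the form
   chi_theta (x) psi with psi(x - k) = e_r(k) psi(x) for all k in <t>, that is, with psi in the
   span of the f_{r,s}. Each such nonzero vector generates a space Ind<...> which is irreducible
   (project with chi_theta over the lamp group) and equivalent to the induced representation
   (Frobenius reciprocity). Conversely, any irreducible W equivalent to the induced
   representation contains such a vector; expanding psi in the basis phi_{r,j} shows that W meets
   the sum of the spaces Ind<...>, hence is contained in it. Distinct summands are orthogonal.
   The operator M commutes with translations and sends chi_theta (x) f to
   chi_theta (x) M_theta f. *)
theory Submission
  imports Defs
begin

section \<open>Finiteness of \<open>C_2\<close> and arithmetic in the wreath product\<close>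

instance bit :: finite
proof
  have "(UNIV :: bit set) \<subseteq> {0, 1}"
    using bit_not_zero_iff by blast
  then show "finite (UNIV :: bit set)"
    by (rule finite_subset) simp
qed

lemma bit_add_self [simp]: "(\<omega> :: 'a \<Rightarrow> bit) + \<omega> = 0"
proof
  fix x show "(\<omega> + \<omega>) x = 0 x" by (cases "\<omega> x = 0") simp_all
qed

lemma shift_zero [simp]: "shift 0 f = f"
  by (simp add: shift_def)

lemma shift_shift [simp]: "shift a (shift b f) = shift (a + b) f"
  by (simp add: shift_def algebra_simps)

lemma shift_add: "shift k (f + g) = shift k f + shift k g"
  by (simp add: shift_def fun_eq_iff)

lemma shift_zero_fun [simp]: "shift k (0 :: _ \<Rightarrow> 'b::zero) = 0"
  by (simp add: shift_def fun_eq_iff)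

lemma shift_fscale: "shift k (fscale c f) = fscale c (shift k f)"
  by (simp add: shift_def fscale_def)

lemma lamplighter_mult [simp]:
  "(\<theta>, k) \<otimes>\<^bsub>lamplighter\<^esub> (\<omega>, h) = (\<theta> + shift k \<omega>, k + h)"
  by (simp add: lamplighter_def)

lemma lamplighter_carrier [simp]: "carrier lamplighter = UNIV"
  by (simp add: lamplighter_def)

lemma lamplighter_one [simp]: "\<one>\<^bsub>lamplighter\<^esub> = (0, 0)"
  by (simp add: lamplighter_def)

interpretation lamplighter: group lamplighter
  by (rule group_lamplighter)

text \<open>Every lamp configuration is its own negative, so inverting only rotates it back and no
  sign appears in the first component.\<close>

lemma lamplighter_inv: "inv\<^bsub>lamplighter\<^esub> (\<omega>, k) = (shift (- k) \<omega>, - k)"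
  by (rule lamplighter.inv_equality) (simp_all flip: shift_add)

lemma left_transl_lamplighter:
  "left_transl lamplighter (\<alpha>, k) f (\<eta>, x) = f (shift (- k) (\<alpha> + \<eta>), x - k)"
  by (simp add: left_transl_def lamplighter_inv shift_add)

subsection \<open>Characters of the lamp group\<close>

text \<open>Trading the exponent sum for a product of signs lets multiplicativity be checked lamp by
  lamp and rotations be handled by reindexing.\<close>

lemma chi_prod: "chi \<theta> \<omega> = (\<Prod>j\<in>UNIV. if \<theta> j = 1 \<and> \<omega> j = 1 then -1 else 1)"
  unfolding chi_def power_sum
  by (rule prod.cong) (auto simp: of_bool_def)

lemma chi_commute: "chi \<theta> \<omega> = chi \<omega> \<theta>"
  by (simp add: chi_def mult.commute)

lemma chi_add: "chi \<theta> (\<omega> + \<eta>) = chi \<theta> \<omega> * chi \<theta> \<eta>"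
  unfolding chi_prod prod.distrib[symmetric]
proof (rule prod.cong)
  fix j
  show "(if \<theta> j = 1 \<and> (\<omega> + \<eta>) j = 1 then - 1 else 1) =
    (if \<theta> j = 1 \<and> \<omega> j = 1 then - 1 else 1) * (if \<theta> j = 1 \<and> \<eta> j = 1 then - 1 else 1 :: complex)"
    by (cases "\<omega> j = 0"; cases "\<eta> j = 0") auto
qed simp

lemma chi_add_left: "chi (\<theta> + \<eta>) \<omega> = chi \<theta> \<omega> * chi \<eta> \<omega>"
  using chi_add[of \<omega> \<theta> \<eta>] by (simp add: chi_commute)

lemma chi_square [simp]: "chi \<theta> \<omega> * chi \<theta> \<omega> = 1"
  by (simp add: chi_prod flip: prod.distrib)
     (rule prod.neutral, auto)

lemma chi_nonzero [simp]: "chi \<theta> \<omega> \<noteq> 0"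
  by (metis chi_square mult_zero_left zero_neq_one)

lemma chi_zero [simp]: "chi \<theta> 0 = 1"
  by (simp add: chi_def)

lemma cnj_chi [simp]: "cnj (chi \<theta> \<omega>) = chi \<theta> \<omega>"
  by (simp add: chi_def)

lemma chi_delta: "chi \<theta> (delta x) = 1 - 2 * of_bit (\<theta> x)"
proof -
  have "chi \<theta> (delta x) = (\<Prod>j\<in>UNIV. if j = x then (if \<theta> x = 1 then -1 else 1) else 1)"
    unfolding chi_prod by (rule prod.cong) (auto simp: delta_def)
  then show ?thesis by simp
qed

text \<open>Reindexing the circle moves a rotation from the argument to the index of the character.
  This is why left translation carries \<open>chi \<theta>\<close> to the character of a rotated
  configuration.\<close>

lemma chi_shift: "chi \<theta> (shift (- k) \<omega>) = chi (shift k \<theta>) \<omega>"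
  unfolding chi_prod shift_def
  by (rule prod.reindex_bij_witness[of _ "\<lambda>j. j - k" "\<lambda>j. j + k"]) auto

text \<open>The product of the two characters is \<open>chi (\<theta> + \<eta>)\<close>. Toggling a
  lamp \<open>j\<close> at which the two configurations differ reverses its sign, so the sum equals
  its own negative.\<close>

lemma chi_orthogonal:
  assumes "\<theta> \<noteq> \<eta>"
  shows "(\<Sum>\<omega>\<in>UNIV. chi \<theta> \<omega> * chi \<eta> \<omega>) = 0"
proof -
  from assms obtain j where "\<theta> j \<noteq> \<eta> j" by auto
  then have "(\<theta> + \<eta>) j = 1"
    by (cases "\<theta> j = 0"; cases "\<eta> j = 0") auto
  then have neg: "chi (\<theta> + \<eta>) (\<omega> + delta j) = - chi (\<theta> + \<eta>) \<omega>" for \<omega>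
    unfolding chi_add chi_delta by simp
  have "(\<Sum>\<omega>\<in>UNIV. chi (\<theta> + \<eta>) \<omega>) = (\<Sum>\<omega>\<in>UNIV. chi (\<theta> + \<eta>) (\<omega> + delta j))"
    by (rule sum.reindex_bij_witness[of _ "\<lambda>\<omega>. \<omega> + delta j" "\<lambda>\<omega>. \<omega> + delta j"])
       (simp_all add: add.assoc)
  also have "\<dots> = - (\<Sum>\<omega>\<in>UNIV. chi (\<theta> + \<eta>) \<omega>)"
    by (simp add: neg sum_negf)
  finally show ?thesis
    by (simp add: chi_add_left)
qed

subsection \<open>Translations and the scalar product\<close>

lemma tensor_apply [simp]: "(F \<otimes>\<^sub>f f) (\<omega>, x) = F \<omega> * f x"
  by (simp add: tensor_def)

lemma tensor_add: "F \<otimes>\<^sub>f (f + g) = F \<otimes>\<^sub>f f + F \<otimes>\<^sub>f g"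
  by (simp add: fun_eq_iff algebra_simps)

lemma tensor_fscale: "F \<otimes>\<^sub>f fscale c f = fscale c (F \<otimes>\<^sub>f f)"
  by (simp add: fun_eq_iff fscale_def)

lemma chi_tensor_eq_0_iff [simp]: "chi \<theta> \<otimes>\<^sub>f f = 0 \<longleftrightarrow> f = 0"
  by (auto simp: fun_eq_iff)

text \<open>The lamp part of a group element contributes only a scalar, while its rotation part
  moves both tensor factors together. All later orbit computations rest on this formula.\<close>

lemma left_transl_chi_tensor:
  "left_transl lamplighter (\<alpha>, k) (chi \<theta> \<otimes>\<^sub>f f) =
     fscale (chi (shift k \<theta>) \<alpha>) (chi (shift k \<theta>) \<otimes>\<^sub>f shift k f)"
  by (rule ext) (clarsimp simp: left_transl_lamplighter fscale_def chi_shift chi_add shift_def[of k f])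

lemma left_transl_add: "left_transl G a (f + g) = left_transl G a f + left_transl G a g"
  by (simp add: left_transl_def fun_eq_iff)

lemma left_transl_fscale: "left_transl G a (fscale c f) = fscale c (left_transl G a f)"
  by (simp add: left_transl_def fscale_def)

lemma left_transl_mult:
  "left_transl lamplighter a (left_transl lamplighter b f) =
     left_transl lamplighter (a \<otimes>\<^bsub>lamplighter\<^esub> b) f"
  by (simp add: left_transl_def fun_eq_iff lamplighter.inv_mult_group lamplighter.m_assoc)

lemma left_transl_one [simp]: "left_transl lamplighter (0, 0) f = f"
  by (rule ext) (clarsimp simp: left_transl_lamplighter)

lemma scalar_prod_add_left: "scalar_prod (f + g) h = scalar_prod f h + scalar_prod g h"
  by (simp add: scalar_prod_def algebra_simps sum.distrib)

lemma scalar_prod_add_right: "scalar_prod h (f + g) = scalar_prod h f + scalar_prod h g"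
  by (simp add: scalar_prod_def algebra_simps sum.distrib)

lemma scalar_prod_fscale_left: "scalar_prod (fscale c f) h = c * scalar_prod f h"
  by (simp add: scalar_prod_def fscale_def sum_distrib_left algebra_simps)

lemma scalar_prod_diff_left: "scalar_prod (f - g) h = scalar_prod f h - scalar_prod g h"
  by (simp add: scalar_prod_def algebra_simps sum_subtractf)

lemma scalar_prod_fscale_right: "scalar_prod h (fscale c f) = cnj c * scalar_prod h f"
  by (simp add: scalar_prod_def fscale_def sum_distrib_left algebra_simps)

lemma scalar_prod_zero [simp]: "scalar_prod 0 f = 0" "scalar_prod f 0 = 0"
  by (simp_all add: scalar_prod_def)

lemma scalar_prod_sum_left: "scalar_prod (\<Sum>i\<in>I. f i) h = (\<Sum>i\<in>I. scalar_prod (f i) h)"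
  by (induction I rule: infinite_finite_induct)
     (simp_all add: scalar_prod_add_left del: zero_fun_apply plus_fun_apply)

lemma scalar_prod_self_eq_0 [simp]: "scalar_prod f f = 0 \<longleftrightarrow> f = 0"
proof
  assume "scalar_prod f f = 0"
  then have "complex_of_real (\<Sum>x\<in>UNIV. (cmod (f x))\<^sup>2) = 0"
    by (simp only: scalar_prod_def of_real_sum complex_norm_square)
  then have "(\<Sum>x\<in>UNIV. (cmod (f x))\<^sup>2) = 0"
    using of_real_eq_0_iff by blast
  then show "f = 0"
    by (simp add: sum_nonneg_eq_0_iff fun_eq_iff)
qed simp

lemma scalar_prod_left_transl:
  "scalar_prod (left_transl lamplighter a f) (left_transl lamplighter a g) = scalar_prod f g"
  unfolding scalar_prod_def left_transl_def
  by (rule sum.reindex_bij_witness[of _ "\<lambda>b. a \<otimes>\<^bsub>lamplighter\<^esub> b"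
        "\<lambda>b. inv\<^bsub>lamplighter\<^esub> a \<otimes>\<^bsub>lamplighter\<^esub> b"])
     (simp_all flip: lamplighter.m_assoc)

lemma scalar_prod_tensor:
  "scalar_prod (F \<otimes>\<^sub>f f) (G \<otimes>\<^sub>f g) = scalar_prod F G * scalar_prod f g"
  by (simp add: scalar_prod_def sum_product UNIV_Times_UNIV[symmetric] sum.cartesian_product
        mult_ac del: UNIV_Times_UNIV)
     (simp add: case_prod_unfold tensor_def mult_ac)

lemma scalar_prod_chi: "\<theta> \<noteq> \<eta> \<Longrightarrow> scalar_prod (chi \<theta>) (chi \<eta>) = 0"
  by (simp add: scalar_prod_def chi_orthogonal)

lemma scalar_prod_shift: "scalar_prod (shift k f) (shift k g) = scalar_prod f g"
  unfolding scalar_prod_def shift_def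
  by (rule sum.reindex_bij_witness[of _ "\<lambda>x. x + k" "\<lambda>x. x - k"]) auto

lemma orthogonal_span:
  assumes "\<And>f g. f \<in> A \<Longrightarrow> g \<in> B \<Longrightarrow> scalar_prod f g = 0"
    and "f \<in> cfun.span A" "g \<in> cfun.span B"
  shows "scalar_prod f g = 0"
proof -
  have "scalar_prod f g = 0" if "f \<in> A" for f
    using assms(3)
    by (induction rule: cfun.span_induct_alt)
       (simp_all add: scalar_prod_add_right scalar_prod_fscale_right assms(1) that
          del: zero_fun_apply plus_fun_apply)
  with assms(2) show ?thesis
    by (induction rule: cfun.span_induct_alt)
       (simp_all add: scalar_prod_add_left scalar_prod_fscale_left
          del: zero_fun_apply plus_fun_apply)
qed

subsection \<open>Periods and characters of subgroups of the cyclic group\<close>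

lemma of_nat_mod_ring_eq_iff:
  "(of_nat a :: 'n::nontriv mod_ring) = of_nat b \<longleftrightarrow> a mod CARD('n) = b mod CARD('n)"
proof -
  have "Rep_mod_ring (of_nat a :: 'n mod_ring) = int (a mod CARD('n))" for a
    by (simp add: of_nat_of_int_mod_ring of_int_mod_ring.rep_eq zmod_int)
  then show ?thesis
    by (metis Rep_mod_ring_inject of_nat_eq_iff)
qed

lemma mod_ring_eq_of_nat:
  obtains a where "a < CARD('n)" "(x :: 'n::nontriv mod_ring) = of_nat a"
proof
  have r: "0 \<le> to_int_mod_ring x" "to_int_mod_ring x < CARD('n)"
    using range_to_int_mod_ring[where ?'a = 'n] by (auto simp: set_eq_iff image_iff) 
  then show "nat (to_int_mod_ring x) < CARD('n)" by simp
  show "x = of_nat (nat (to_int_mod_ring x))"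
    using r by (simp add: of_nat_of_int_mod_ring)
qed

lemma to_int_mod_ring_of_nat:
  "to_int_mod_ring (of_nat a :: 'n::nontriv mod_ring) = int (a mod CARD('n))"
proof -
  have "(of_nat a :: 'n mod_ring) = of_nat (a mod CARD('n))"
    by (simp add: of_nat_mod_ring_eq_iff)
  also have "to_int_mod_ring \<dots> = int (a mod CARD('n))"
    unfolding of_nat_of_int_mod_ring comp_def by (rule to_int_mod_ring_of_int_mod_ring) simp_all
  finally show ?thesis .
qed

text \<open>As powers of one root of unity, the characters can be computed on arbitrary natural
  representatives, without tracking reduction modulo \<open>CARD('n)\<close>.\<close>

lemma e_char_of_nat:
  "e_char r (of_nat a :: 'n::nontriv mod_ring) = cis (2 * pi * real r / real CARD('n)) ^ a"
proof -
  define w where "w = cis (2 * pi * real r / real CARD('n))"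
  have "w ^ CARD('n) = cis (2 * pi * real r)"
    by (simp add: w_def DeMoivre)
  also have "\<dots> = 1"
    by (rule cis_multiple_2pi) simp
  finally have "w ^ a = w ^ (a mod CARD('n))"
    by (metis div_mult_mod_eq mult.commute power_add power_mult power_one mult_1)
  also have "\<dots> = e_char r (of_nat a :: 'n mod_ring)"
    unfolding w_def DeMoivre unfolding e_char_def to_int_mod_ring_of_nat cis_conv_exp
    by (rule arg_cong[where f = exp]) simp
  finally show ?thesis by (simp add: w_def)
qed

lemma e_char_add: "e_char r (h + k) = e_char r h * e_char r (k :: 'n::nontriv mod_ring)"
proof -
  obtain a b where "h = of_nat a" "k = of_nat b"
    using mod_ring_eq_of_nat by metis
  then show ?thesis
    by (simp add: e_char_of_nat power_add flip: of_nat_add)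
qed

lemma e_char_zero [simp]: "e_char r (0 :: 'n::nontriv mod_ring) = 1"
  using e_char_of_nat[of r 0] by simp

lemma e_char_neq_0 [simp]: "e_char r h \<noteq> 0"
  by (simp add: e_char_def)

lemma e_char_minus: "e_char r (- h) = inverse (e_char r (h :: 'n::nontriv mod_ring))"
  using e_char_add[of r h "- h"] by (simp add: field_simps)

lemma cnj_e_char: "cnj (e_char r h) = e_char r (- h :: 'n::nontriv mod_ring)"
proof -
  obtain a where a: "h = of_nat a"
    using mod_ring_eq_of_nat by metis
  then have "cmod (e_char r h) = 1"
    by (simp add: e_char_of_nat norm_power)
  then have "e_char r h * cnj (e_char r h) = 1"
    using complex_norm_square[of "e_char r h"] by simp
  then show ?thesis
    by (simp add: e_char_minus field_simps)
qed

lemma e_char_add_index: "e_char (r + q) h = e_char r h * e_char q h"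
  by (simp add: e_char_def algebra_simps add_divide_distrib flip: exp_add)

lemma mem_cyc_subgroupI [intro]: "of_nat (l * t) \<in> cyc_subgroup t"
  by (auto simp: cyc_subgroup_def)

lemma cyc_subgroup_add: "h \<in> cyc_subgroup t \<Longrightarrow> k \<in> cyc_subgroup t \<Longrightarrow> h + k \<in> cyc_subgroup t"
  unfolding cyc_subgroup_def by clarsimp (metis distrib_right of_nat_add of_nat_mult)

text \<open>Since \<open>t\<close> divides the order of the group, a residue modulo
  \<open>CARD('n)\<close> determines the residue modulo \<open>t\<close>, so the choice of
  representative does not matter.\<close>

lemma of_nat_mem_cyc_subgroup:
  assumes "t dvd CARD('n)"
  shows "(of_nat a :: 'n::nontriv mod_ring) \<in> cyc_subgroup t \<longleftrightarrow> t dvd a"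
proof
  assume "(of_nat a :: 'n mod_ring) \<in> cyc_subgroup t"
  then obtain l where "a mod CARD('n) = (l * t) mod CARD('n)"
    unfolding cyc_subgroup_def mem_Collect_eq of_nat_mod_ring_eq_iff by blast
  then have "a mod t = (l * t) mod t"
    by (metis assms mod_mod_cancel)
  then show "t dvd a" by (simp add: dvd_eq_mod_eq_0)
next
  assume "t dvd a"
  then show "(of_nat a :: 'n mod_ring) \<in> cyc_subgroup t"
    by (metis dvd_def mult.commute mem_cyc_subgroupI)
qed

lemma cyc_subgroup_uminus:
  assumes "t dvd CARD('n)" and "(h :: 'n::nontriv mod_ring) \<in> cyc_subgroup t"
  shows "- h \<in> cyc_subgroup t"
proof -
  obtain a where a: "a < CARD('n)" "h = of_nat a"
    using mod_ring_eq_of_nat by metis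
  then have "- h = of_nat (CARD('n) - a)"
    by (simp add: of_nat_diff)
  moreover have "t dvd CARD('n) - a"
    using a assms by (simp add: of_nat_mem_cyc_subgroup dvd_diff_nat)
  ultimately show ?thesis
    using assms(1) by (simp only: of_nat_mem_cyc_subgroup)
qed

lemma cyc_subgroup_coset:
  assumes "t > 0"
  obtains s h where "s < t" "h \<in> cyc_subgroup t" "(k :: 'n::nontriv mod_ring) = of_nat s + h"
proof -
  obtain a where "k = of_nat a"
    using mod_ring_eq_of_nat by metis
  then have "k = of_nat (a mod t) + of_nat (a div t * t)"
    by (metis mod_div_mult_eq of_nat_add)
  then show thesis
    using that[of "a mod t" "of_nat (a div t * t)"] assms by (metis mem_cyc_subgroupI mod_less_divisor)
qed

lemma cyc_subgroup_coset_unique: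
  assumes "t dvd CARD('n)" "s < t" "s' < t"
    and "(of_nat s - of_nat s' :: 'n::nontriv mod_ring) \<in> cyc_subgroup t"
  shows "s = s'"
proof (rule ccontr)
  assume "s \<noteq> s'"
  \<comment> \<open>Subtraction of naturals truncates at 0, so the divisibility is proved for an
    ordered pair and then used in both orders. A positive multiple of \<open>t\<close> cannot stay
    below \<open>t\<close>.\<close>
  have d: "t dvd s - s'" if "s' \<le> s" "(of_nat s - of_nat s' :: 'n mod_ring) \<in> cyc_subgroup t" for s s'
    using that assms(1) by (simp add: of_nat_mem_cyc_subgroup flip: of_nat_diff)
  have "(of_nat s' - of_nat s :: 'n mod_ring) \<in> cyc_subgroup t"
    using cyc_subgroup_uminus[OF assms(1) assms(4)] by simp
  with \<open>s \<noteq> s'\<close> d[of s' s] d[of s s'] assms show False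
    by (cases "s' \<le> s") (auto dest: dvd_imp_le)
qed

lemma period_ex: "0 < CARD('n) \<and> (\<forall>k. \<theta> (k + of_nat CARD('n) :: 'n::nontriv mod_ring) = \<theta> k)"
  by simp

lemma period_pos: "period \<theta> > 0"
  using LeastI[of "\<lambda>t. 0 < t \<and> (\<forall>k. \<theta> (k + of_nat t) = \<theta> k)", OF period_ex]
  by (simp add: period_def)

lemma shift_eq_self_iff: "shift k f = f \<longleftrightarrow> (\<forall>j. f (j + k) = f j)"
  unfolding shift_def fun_eq_iff by (metis add_diff_cancel diff_add_cancel)

lemma shift_period: "shift (of_nat (period \<theta>)) \<theta> = \<theta>"
  using LeastI[of "\<lambda>t. 0 < t \<and> (\<forall>k. \<theta> (k + of_nat t) = \<theta> k)", OF period_ex]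
  by (simp add: period_def shift_eq_self_iff)

text \<open>Multiples of the period fix \<open>\<theta>\<close>, so the remainder of
  \<open>a\<close> fixes it as well. Being smaller than the least positive period, that remainder is
  0.\<close>

lemma shift_of_nat_eq_self_iff: "shift (of_nat a) \<theta> = \<theta> \<longleftrightarrow> period \<theta> dvd a"
proof
  have mult: "shift (of_nat (q * period \<theta>)) \<theta> = \<theta>" for q
  proof (induction q)
    case (Suc q)
    have "shift (of_nat (Suc q * period \<theta>)) \<theta>
        = shift (of_nat (q * period \<theta>)) (shift (of_nat (period \<theta>)) \<theta>)"
      by (simp add: algebra_simps)
    with Suc show ?case by (simp only: shift_period)
  qed simp
  {
    assume "period \<theta> dvd a"
    then show "shift (of_nat a) \<theta> = \<theta>"
      using mult by (metis dvd_def mult.commute)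
  }
  assume a: "shift (of_nat a) \<theta> = \<theta>"
  have "shift (of_nat (a mod period \<theta>)) \<theta>
      = shift (of_nat (a mod period \<theta>)) (shift (of_nat (a div period \<theta> * period \<theta>)) \<theta>)"
    by (simp only: mult)
  also have "\<dots> = shift (of_nat a) \<theta>"
    by (metis shift_shift mod_div_mult_eq of_nat_add)
  finally have "shift (of_nat (a mod period \<theta>)) \<theta> = \<theta>"
    using a by simp
  then have "\<not> 0 < a mod period \<theta>"
    using not_less_Least[of "a mod period \<theta>" "\<lambda>t. 0 < t \<and> (\<forall>k. \<theta> (k + of_nat t) = \<theta> k)"]
      mod_less_divisor[OF period_pos, of a \<theta>]
    by (auto simp: period_def shift_eq_self_iff)
  then show "period \<theta> dvd a" by (simp add: dvd_eq_mod_eq_0)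
qed

lemma period_dvd_card: "period (\<theta> :: 'n::nontriv mod_ring \<Rightarrow> bit) dvd CARD('n)"
  by (simp flip: shift_of_nat_eq_self_iff)

lemma shift_eq_self_iff_cyc: "shift k \<theta> = \<theta> \<longleftrightarrow> k \<in> cyc_subgroup (period \<theta>)"
proof -
  obtain a where "k = of_nat a"
    using mod_ring_eq_of_nat by metis
  then show ?thesis
    by (simp add: shift_of_nat_eq_self_iff of_nat_mem_cyc_subgroup period_dvd_card)
qed

lemma shift_eq_shift_iff: "shift k f = shift h f \<longleftrightarrow> shift (k - h) f = f"
proof -
  have "shift k f = shift h f \<longleftrightarrow> shift (- h) (shift k f) = shift (- h) (shift h f)"
    by (metis shift_shift add.right_inverse shift_zero)
  then show ?thesis by simp
qed

lemma shift_inj_below_period: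
  assumes "shift (of_nat s) \<theta> = shift (of_nat s') \<theta>" "s < period \<theta>" "s' < period \<theta>"
  shows "s = s'"
  using assms cyc_subgroup_coset_unique[OF period_dvd_card]
  by (simp add: shift_eq_shift_iff shift_eq_self_iff_cyc)

section \<open>Functions on \<open>C_n\<close> that transform by \<open>e_r\<close> under the
  subgroup generated by \<open>t\<close>\<close>

lemma sum_fun_apply: "(\<Sum>i\<in>I. f i) x = (\<Sum>i\<in>I. f i x)"
  by (induction I rule: infinite_finite_induct) simp_all

text \<open>This is the eigenspace of the translations by the subgroup for the character
  \<open>e_r\<close>. It serves as a basis-free description of the span of the functions
  \<open>f_fun t r s\<close>.\<close>

definition twisted :: "nat \<Rightarrow> nat \<Rightarrow> ('n::nontriv mod_ring \<Rightarrow> complex) set" where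
  "twisted t r = {f. \<forall>k\<in>cyc_subgroup t. shift k f = fscale (e_char r k) f}"

lemma subspace_twisted: "cfun.subspace (twisted t r)"
  by (rule cfun.subspaceI)
     (auto simp: twisted_def shift_def fscale_def fun_eq_iff algebra_simps)

text \<open>Replaces the explicit list by a coset, for which closure under addition and negation is
  available.\<close>

lemma Omega_iff:
  assumes "t dvd CARD('n)" "t > 0"
  shows "k \<in> Omega t s \<longleftrightarrow> k - of_nat s \<in> (cyc_subgroup t :: 'n::nontriv mod_ring set)"
proof
  assume "k \<in> Omega t s"
  then show "k - of_nat s \<in> cyc_subgroup t"
    unfolding Omega_def by (force simp del: of_nat_mult)
next
  assume "k - of_nat s \<in> cyc_subgroup t"
  then obtain l where l: "k - of_nat s = of_nat (l * t)"
    unfolding cyc_subgroup_def by blast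
  obtain m where m: "CARD('n) = m * t" "m > 0"
    using assms by (metis dvd_def mult.commute zero_less_card_finite zero_less_mult_pos2 mult_pos_pos)
  \<comment> \<open>Because \<open>m * t\<close> is the order of the group, the multiplier
    \<open>l\<close> only matters modulo \<open>m\<close>, which brings it into the range listed in
    \<open>Omega\<close>.\<close>
  have "of_nat (l * t) = (of_nat (l mod m * t) :: 'n mod_ring)"
    unfolding of_nat_mod_ring_eq_iff m by (simp add: mod_mult_mult2)
  then have "k = of_nat (s + l mod m * t)"
    using l by (simp add: algebra_simps)
  moreover have "l mod m < CARD('n) div t"
    using m assms by simp
  ultimately show "k \<in> Omega t s"
    unfolding Omega_def by blast
qed

text \<open>With \<open>m = CARD('n) div t\<close>, the character \<open>e_m\<close> is trivial on
  the subgroup, so there \<open>e_char (m - r)\<close> is the inverse of \<open>e_char r\<close>.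
  The bound on \<open>r\<close> makes the natural subtraction \<open>m - r\<close> genuine.\<close>

lemma f_fun_eq:
  assumes "t dvd CARD('n)" "t > 0" "r < CARD('n) div t"
  shows "f_fun t r s (k :: 'n::nontriv mod_ring) =
    (if k - of_nat s \<in> cyc_subgroup t then e_char r (of_nat s - k) else 0)"
proof -
  have "e_char (CARD('n) div t - r) h = e_char r (- h)"
    if "(h :: 'n mod_ring) \<in> cyc_subgroup t" for h
  proof -
    from that obtain l where h: "h = of_nat (l * t)" by (auto simp: cyc_subgroup_def)
    obtain m where m: "CARD('n) = m * t"
      using assms by (metis dvd_def mult.commute)
    have "e_char m h = cis (real (l * t) * (2 * pi * real m / real CARD('n)))"
      by (simp only: h e_char_of_nat DeMoivre)
    also have "real (l * t) * (2 * pi * real m / real CARD('n)) = 2 * pi * real l"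
      using zero_less_card_finite[where ?'a = 'n] unfolding m by (simp add: field_simps)
    also have "cis \<dots> = 1"
      by (rule cis_multiple_2pi) simp
    finally have "e_char m h = 1" .
    moreover have "m = m - r + r" and "CARD('n) div t = m"
      using m assms by auto
    ultimately show ?thesis
      using e_char_add_index[of "m - r" r h] by (simp add: e_char_minus field_simps)
  qed
  from this[of "k - of_nat s"] show ?thesis
    using assms by (simp add: f_fun_def Omega_iff)
qed

lemma span_f_fun:
  assumes "t dvd CARD('n)" "t > 0" "r < CARD('n) div t"
  shows "cfun.span (f_fun t r ` {..<t}) = (twisted t r :: ('n::nontriv mod_ring \<Rightarrow> complex) set)"
proof (rule antisym[OF cfun.span_minimal])
  show "f_fun t r ` {..<t} \<subseteq> (twisted t r :: ('n mod_ring \<Rightarrow> complex) set)"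
  proof (clarsimp simp: twisted_def)
    fix s and h :: "'n mod_ring" assume h: "h \<in> cyc_subgroup t"
    have "k - h - of_nat s \<in> cyc_subgroup t \<longleftrightarrow> k - of_nat s \<in> cyc_subgroup t" for k
      using cyc_subgroup_add[OF h, of "k - h - of_nat s"]
        cyc_subgroup_add[OF cyc_subgroup_uminus[OF assms(1) h], of "k - of_nat s"]
      by (auto simp: algebra_simps)
    \<comment> \<open>Translation by \<open>h\<close> replaces \<open>k\<close> by
      \<open>k - h\<close>. Since \<open>k\<close> enters the exponent negatively, \<open>h\<close>
      comes out with a plus sign and the eigencharacter is \<open>e_r\<close> rather than its
      inverse.\<close>
    moreover have "e_char r (of_nat s - (k - h)) = e_char r h * e_char r (of_nat s - k)" for k
      unfolding e_char_add[symmetric] by (rule arg_cong) simp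
    ultimately show "shift h (f_fun t r s) = fscale (e_char r h) (f_fun t r s)"
      by (simp add: fun_eq_iff shift_def fscale_def f_fun_eq assms)
  qed
  show "cfun.subspace (twisted t r)"
    by (rule subspace_twisted)
  show "(twisted t r :: ('n mod_ring \<Rightarrow> complex) set) \<subseteq> cfun.span (f_fun t r ` {..<t})"
  proof
    fix f :: "'n mod_ring \<Rightarrow> complex" assume f: "f \<in> twisted t r"
    \<comment> \<open>The numbers below \<open>t\<close> represent the cosets. Each
      \<open>f_fun t r s\<close> is supported on one coset and equals 1 at \<open>s\<close>, so the
      coefficients must be the values of \<open>f\<close> there.\<close>
    have "f = (\<Sum>s<t. fscale (f (of_nat s)) (f_fun t r s))"
    proof
      fix k :: "'n mod_ring"
      obtain s h where k: "s < t" "h \<in> cyc_subgroup t" "k = of_nat s + h"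
        using cyc_subgroup_coset[OF assms(2)] by metis
      have in_coset: "k - of_nat s' \<in> cyc_subgroup t \<longleftrightarrow> s' = s" if "s' < t" for s'
      proof
        assume "k - of_nat s' \<in> cyc_subgroup t"
        then have "- h + (k - of_nat s') \<in> cyc_subgroup t"
          by (rule cyc_subgroup_add[OF cyc_subgroup_uminus[OF assms(1) k(2)]])
        then have "(of_nat s - of_nat s' :: 'n mod_ring) \<in> cyc_subgroup t"
          by (simp add: k(3))
        then show "s' = s"
          using cyc_subgroup_coset_unique[OF assms(1)] k(1) that by blast
      qed (use k in simp)
      have "shift h f k = fscale (e_char r h) f k"
        using f k(2) unfolding twisted_def by simp
      then have fs: "f (of_nat s) = e_char r h * f k"
        by (simp add: shift_def fscale_def k(3))
      have "(\<Sum>s'<t. fscale (f (of_nat s')) (f_fun t r s')) k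
          = (\<Sum>s'<t. if s' = s then f (of_nat s) * e_char r (- h) else 0)"
        unfolding sum_fun_apply
        by (rule sum.cong) (simp_all add: fscale_def f_fun_eq assms in_coset, simp add: k(3))
      also have "\<dots> = f (of_nat s) * e_char r (- h)"
        using k(1) by simp
      also note fs
      finally show "f k = (\<Sum>s'<t. fscale (f (of_nat s')) (f_fun t r s')) k"
        by (simp add: e_char_minus)
    qed
    also have "\<dots> \<in> cfun.span (f_fun t r ` {..<t})"
      by (intro cfun.span_sum cfun.span_scale cfun.span_base) auto
    finally show "f \<in> cfun.span (f_fun t r ` {..<t})" .
  qed
qed

subsection \<open>The spaces spanned by the translates of a tensor product\<close>

lemma additive_map_span:
  assumes add: "\<And>f g. A (f + g) = A f + A g"
    and scale: "\<And>c f. A (fscale c f) = fscale c (A f)"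
    and B: "\<And>f. f \<in> B \<Longrightarrow> A f \<in> W" and W: "cfun.subspace W"
    and f: "f \<in> cfun.span B"
  shows "A f \<in> W"
proof -
  have "cfun.subspace {f. A f \<in> W}"
  proof (rule cfun.subspaceI)
    show "0 \<in> {f. A f \<in> W}"
      using scale[of 0 0] cfun.subspace_0[OF W] by simp
  qed (simp_all add: add scale cfun.subspace_add[OF W] cfun.subspace_scale[OF W])
  moreover have "B \<subseteq> {f. A f \<in> W}" using B by blast
  ultimately show ?thesis using f cfun.span_minimal by blast
qed

text \<open>The generators of the span only involve rotations \<open>s\<close> below the period. Any
  other rotation differs from one of these by an element \<open>h\<close> of the stabilizer, which
  fixes \<open>\<theta>\<close> and multiplies \<open>\<phi>\<close> by
  \<open>e_char r h\<close>.\<close>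

lemma translate_mem_ind_span:
  assumes "\<phi> \<in> twisted (period \<theta>) r"
  shows "chi (shift k \<theta>) \<otimes>\<^sub>f shift k \<phi> \<in> ind_span \<theta> (period \<theta>) \<phi>"
proof -
  obtain s h where k: "s < period \<theta>" "h \<in> cyc_subgroup (period \<theta>)" "k = of_nat s + h"
    using cyc_subgroup_coset[OF period_pos] by metis
  have "shift k \<theta> = shift (of_nat s) (shift h \<theta>)"
    by (simp add: k(3))
  also have "shift h \<theta> = \<theta>"
    using k(2) by (simp add: shift_eq_self_iff_cyc)
  finally have \<theta>: "shift k \<theta> = shift (of_nat s) \<theta>" .
  have "shift k \<phi> = shift (of_nat s) (shift h \<phi>)"
    by (simp add: k(3))
  also have "shift h \<phi> = fscale (e_char r h) \<phi>"
    using k(2) assms by (simp add: twisted_def)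
  finally have \<phi>: "shift k \<phi> = fscale (e_char r h) (shift (of_nat s) \<phi>)"
    by (simp only: shift_fscale)
  show ?thesis
    unfolding ind_span_def \<theta> \<phi> tensor_fscale
    using k(1) by (intro cfun.span_scale cfun.span_base) blast
qed

lemma tensor_mem_ind_span:
  "\<phi> \<in> twisted (period \<theta>) r \<Longrightarrow> chi \<theta> \<otimes>\<^sub>f \<phi> \<in> ind_span \<theta> (period \<theta>) \<phi>"
  using translate_mem_ind_span[of \<phi> \<theta> r 0] by simp

lemma left_transl_tensor_mem_ind_span:
  assumes "\<phi> \<in> twisted (period \<theta>) r"
  shows "left_transl lamplighter g (chi (shift k \<theta>) \<otimes>\<^sub>f shift k \<phi>) \<in> ind_span \<theta> (period \<theta>) \<phi>"
proof (cases g)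
  case (Pair \<alpha> h)
  have "cfun.subspace (ind_span \<theta> (period \<theta>) \<phi>)"
    by (simp add: ind_span_def)
  then show ?thesis
    using translate_mem_ind_span[OF assms, of "h + k"]
    by (simp add: Pair left_transl_chi_tensor cfun.subspace_scale)
qed

lemma subrep_ind_span:
  assumes "\<phi> \<in> twisted (period \<theta>) r"
  shows "subrep lamplighter (ind_span \<theta> (period \<theta>) \<phi>)"
proof -
  have sub: "cfun.subspace (ind_span \<theta> (period \<theta>) \<phi>)"
    by (simp add: ind_span_def)
  moreover have "left_transl lamplighter a f \<in> ind_span \<theta> (period \<theta>) \<phi>"
    if "f \<in> ind_span \<theta> (period \<theta>) \<phi>" for a f
    using left_transl_add left_transl_fscale _ sub that[unfolded ind_span_def]
    by (rule additive_map_span) (auto intro: left_transl_tensor_mem_ind_span[OF assms])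
  ultimately show ?thesis
    by (simp add: subrep_def)
qed

text \<open>Averaging over the two states of the lamp on edge \<open>x\<close> multiplies the
  character by \<open>(1 + chi \<theta> (delta x)) / 2\<close>, that is, by 1 if
  \<open>\<theta> x\<close> is 0 and by 0 otherwise. These are the weights in
  \<open>M_op\<close>.\<close>

lemma edge_markov_tensor: "edge_markov (chi \<theta> \<otimes>\<^sub>f f) = chi \<theta> \<otimes>\<^sub>f M_op \<theta> f"
  by (rule ext) (clarsimp simp: edge_markov_def M_op_def chi_add chi_delta field_simps)

lemma edge_markov_add: "edge_markov (\<Phi> + \<Psi>) = edge_markov \<Phi> + edge_markov \<Psi>"
  by (simp add: edge_markov_def fun_eq_iff algebra_simps add_divide_distrib)

lemma edge_markov_fscale: "edge_markov (fscale a \<Phi>) = fscale a (edge_markov \<Phi>)"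
  by (simp add: edge_markov_def fscale_def fun_eq_iff algebra_simps)

lemma M_op_shift: "M_op (shift k \<theta>) (shift k f) = shift k (M_op \<theta> f)"
  by (simp add: M_op_def shift_def fun_eq_iff algebra_simps)

text \<open>Rotating \<open>\<theta>\<close> and \<open>\<phi>\<close> together commutes with
  \<open>M_op\<close>, so all generators share the eigenvalue \<open>c\<close>.\<close>

lemma edge_markov_ind_span:
  assumes "M_op \<theta> \<phi> = fscale c \<phi>" and "\<Phi> \<in> ind_span \<theta> t \<phi>"
  shows "edge_markov \<Phi> = fscale c \<Phi>"
proof -
  have "cfun.subspace {\<Phi>. edge_markov \<Phi> = fscale c \<Phi>}"
    by (rule cfun.subspaceI)
       (auto simp: edge_markov_add edge_markov_fscale cfun.scale_right_distrib mult.commute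
         intro: edge_markov_fscale[of 0 0, simplified])
  moreover have "{chi (shift (of_nat s) \<theta>) \<otimes>\<^sub>f shift (of_nat s) \<phi> | s. s < t}
      \<subseteq> {\<Phi>. edge_markov \<Phi> = fscale c \<Phi>}"
    by (auto simp: edge_markov_tensor M_op_shift assms(1) shift_fscale tensor_fscale)
  ultimately show ?thesis
    using assms(2) cfun.span_minimal unfolding ind_span_def by blast
qed

section \<open>The inducing character and its matrix coefficients\<close>

lemma left_transl_tensor_sub_lamplighter:
  assumes "\<phi> \<in> twisted (period \<theta>) r" "h \<in> sub_lamplighter (period \<theta>)"
  shows "left_transl lamplighter h (chi \<theta> \<otimes>\<^sub>f \<phi>) = fscale ((chi \<theta> \<otimes>\<^sub>f e_char r) h) (chi \<theta> \<otimes>\<^sub>f \<phi>)"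
proof (cases h)
  case (Pair \<alpha> k)
  with assms have "shift k \<theta> = \<theta>" "shift k \<phi> = fscale (e_char r k) \<phi>"
    by (auto simp: sub_lamplighter_def twisted_def shift_eq_self_iff_cyc)
  then show ?thesis
    by (simp add: Pair left_transl_chi_tensor tensor_fscale)
qed

text \<open>The rotation part of \<open>h\<close> stabilizes \<open>\<theta>\<close>, so the rotated
  lamp part of the inverse has the same real value under \<open>chi \<theta>\<close>, and only the
  unimodular factor \<open>e_char r\<close> is conjugated.\<close>

lemma induced_character_inv:
  assumes "h \<in> sub_lamplighter (period \<theta>)"
  shows "(chi \<theta> \<otimes>\<^sub>f e_char r) (inv\<^bsub>lamplighter\<^esub> h) = cnj ((chi \<theta> \<otimes>\<^sub>f e_char r) h)"
proof (cases h)
  case (Pair \<alpha> k)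
  with assms have "shift k \<theta> = \<theta>"
    by (simp add: sub_lamplighter_def shift_eq_self_iff_cyc)
  then show ?thesis
    by (simp add: Pair lamplighter_inv chi_shift cnj_e_char)
qed

lemma induced_character_norm:
  assumes "h \<in> sub_lamplighter (period \<theta>)"
  shows "(chi \<theta> \<otimes>\<^sub>f e_char r) (inv\<^bsub>lamplighter\<^esub> h) * (chi \<theta> \<otimes>\<^sub>f e_char r) h = 1"
  using induced_character_inv[OF assms, of r]
  by (cases h) (simp add: cnj_e_char e_char_minus algebra_simps)

text \<open>A rotation outside the stabilizer produces a different lamp character, and orthogonality
  of characters annihilates the lamp factor.\<close>

lemma scalar_prod_left_transl_outside:
  assumes "h \<notin> sub_lamplighter (period \<theta>)"
  shows "scalar_prod (left_transl lamplighter h (chi \<theta> \<otimes>\<^sub>f f)) (chi \<theta> \<otimes>\<^sub>f g) = 0"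
proof (cases h)
  case (Pair \<alpha> k)
  with assms have "shift k \<theta> \<noteq> \<theta>"
    by (simp add: sub_lamplighter_def shift_eq_self_iff_cyc)
  then show ?thesis
    by (simp add: Pair left_transl_chi_tensor scalar_prod_fscale_left scalar_prod_tensor scalar_prod_chi)
qed

lemma left_transl_tensor_shift:
  "left_transl lamplighter (0, k) (chi \<theta> \<otimes>\<^sub>f f) = chi (shift k \<theta>) \<otimes>\<^sub>f shift k f"
  by (simp add: left_transl_chi_tensor fscale_def)

text \<open>The generators of the span are themselves translates, so such a vector is orthogonal to
  itself. This gives injectivity of the matrix coefficient map and later starts the irreducibility
  argument.\<close>

lemma ind_span_eq_0:
  assumes "\<Psi> \<in> ind_span \<theta> t \<phi>"
    and "\<And>g. scalar_prod \<Psi> (left_transl lamplighter g (chi \<theta> \<otimes>\<^sub>f \<phi>)) = 0"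
  shows "\<Psi> = 0"
proof -
  have "scalar_prod \<Psi> \<Psi> = 0"
  proof (rule orthogonal_span)
    show "\<Psi> \<in> cfun.span {\<Psi>}" by (simp add: cfun.span_base)
    show "\<Psi> \<in> cfun.span {chi (shift (of_nat s) \<theta>) \<otimes>\<^sub>f shift (of_nat s) \<phi> | s. s < t}"
      using assms(1) by (simp add: ind_span_def)
  qed (auto simp: assms(2) simp flip: left_transl_tensor_shift)
  then show ?thesis by simp
qed

text \<open>Frobenius reciprocity: a vector on which the subgroup acts by the inducing character
  turns elements into matrix coefficients lying in the induced representation.\<close>

lemma equivalent_ind_span_induced_rep:
  fixes \<theta> :: "'n::nontriv mod_ring \<Rightarrow> bit"
  assumes \<phi>: "\<phi> \<in> twisted (period \<theta>) r" and "\<phi> \<noteq> 0"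
  shows "equivalent_subreps lamplighter (ind_span \<theta> (period \<theta>) \<phi>)
           (induced_rep lamplighter (sub_lamplighter (period \<theta>)) (chi \<theta> \<otimes>\<^sub>f e_char r))"
    (is "equivalent_subreps _ ?U (induced_rep _ ?H ?\<sigma>)")
proof -
  define \<Phi> where "\<Phi> = chi \<theta> \<otimes>\<^sub>f \<phi>"
  define T where "T \<Psi> g = scalar_prod \<Psi> (left_transl lamplighter g \<Phi>)" for \<Psi> g
  have U: "subrep lamplighter ?U"
    using \<phi> by (rule subrep_ind_span)
  then have Usub: "cfun.subspace ?U" and Utr: "\<And>a f. f \<in> ?U \<Longrightarrow> left_transl lamplighter a f \<in> ?U"
    by (auto simp only: subrep_def lamplighter_carrier UNIV_I)
  have \<Phi>U: "\<Phi> \<in> ?U"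
    unfolding \<Phi>_def using \<phi> by (rule tensor_mem_ind_span)
  have \<Phi>\<sigma>: "left_transl lamplighter h \<Phi> = fscale (?\<sigma> h) \<Phi>" if "h \<in> ?H" for h
    unfolding \<Phi>_def using \<phi> that by (rule left_transl_tensor_sub_lamplighter)
  have inj: "inj_on T ?U"
  proof (rule inj_onI)
    fix \<Psi> \<Psi>' assume *: "\<Psi> \<in> ?U" "\<Psi>' \<in> ?U" "T \<Psi> = T \<Psi>'"
    then have "\<Psi> - \<Psi>' \<in> ?U"
      by (intro cfun.subspace_diff Usub)
    moreover have "scalar_prod (\<Psi> - \<Psi>') (left_transl lamplighter g (chi \<theta> \<otimes>\<^sub>f \<phi>)) = 0" for g
      using fun_cong[OF *(3), of g] by (simp add: T_def \<Phi>_def scalar_prod_diff_left)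
    ultimately have "\<Psi> - \<Psi>' = 0"
      by (rule ind_span_eq_0)
    then show "\<Psi> = \<Psi>'" by simp
  qed
  have into: "T \<Psi> \<in> induced_rep lamplighter ?H ?\<sigma>" for \<Psi>
  proof -
    \<comment> \<open>The scalar product is conjugate linear in its second argument, which turns the
      eigenvalue \<open>?\<sigma> h\<close> into the value of \<open>?\<sigma>\<close> at the
      inverse of \<open>h\<close>.\<close>
    have "T \<Psi> (g \<otimes>\<^bsub>lamplighter\<^esub> h) = ?\<sigma> (inv\<^bsub>lamplighter\<^esub> h) * T \<Psi> g" if "h \<in> ?H" for g h
      unfolding T_def induced_character_inv[OF that]
      by (simp add: \<Phi>\<sigma>[OF that] left_transl_fscale scalar_prod_fscale_right flip: left_transl_mult)
    then show ?thesis
      by (simp add: induced_rep_def)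
  qed
  have onto: "\<exists>\<Psi>\<in>?U. T \<Psi> = F" if F: "F \<in> induced_rep lamplighter ?H ?\<sigma>" for F
  proof -
    \<comment> \<open>The preimage of \<open>F\<close> is the sum of the translates of
      \<open>\<Phi>\<close> weighted by \<open>F\<close>. The constant \<open>c\<close> normalizes
      it: each of the \<open>card ?H\<close> surviving terms below contributes
      \<open>F g * scalar_prod \<Phi> \<Phi>\<close>.\<close>
    define c where "c = of_nat (card ?H) * scalar_prod \<Phi> \<Phi>"
    define \<Psi> where "\<Psi> = fscale (1 / c) (\<Sum>g\<in>UNIV. fscale (F g) (left_transl lamplighter g \<Phi>))"
    have "(0, 0) \<in> ?H"
      using mem_cyc_subgroupI[of 0 "period \<theta>"] by (simp add: sub_lamplighter_def)
    then have "card ?H \<noteq> 0" by auto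
    moreover have "scalar_prod \<Phi> \<Phi> \<noteq> 0"
      using \<open>\<phi> \<noteq> 0\<close> by (simp add: \<Phi>_def)
    ultimately have "c \<noteq> 0"
      by (simp add: c_def)
    have "\<Psi> \<in> ?U"
      unfolding \<Psi>_def by (intro cfun.subspace_scale cfun.subspace_sum Usub Utr \<Phi>U)
    moreover have "T \<Psi> g = F g" for g
    proof -
      let ?s = "\<lambda>h. scalar_prod (left_transl lamplighter h \<Phi>) \<Phi>"
      \<comment> \<open>On the subgroup the factors of \<open>F\<close> and of \<open>\<Phi>\<close>
        are inverse to each other; off the subgroup the scalar product vanishes.\<close>
      have s: "F (g \<otimes>\<^bsub>lamplighter\<^esub> h) * ?s h = (if h \<in> ?H then F g * scalar_prod \<Phi> \<Phi> else 0)" for h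
      proof (cases "h \<in> ?H")
        case True
        with F have "F (g \<otimes>\<^bsub>lamplighter\<^esub> h) = ?\<sigma> (inv\<^bsub>lamplighter\<^esub> h) * F g"
          by (simp add: induced_rep_def del: split_paired_All)
        then have "F (g \<otimes>\<^bsub>lamplighter\<^esub> h) * ?s h
            = (?\<sigma> (inv\<^bsub>lamplighter\<^esub> h) * ?\<sigma> h) * (F g * scalar_prod \<Phi> \<Phi>)"
          by (simp only: \<Phi>\<sigma>[OF True] scalar_prod_fscale_left mult_ac)
        then show ?thesis
          by (simp only: induced_character_norm[OF True] True if_True mult_1)
      next
        case False
        then show ?thesis
          by (simp add: \<Phi>_def scalar_prod_left_transl_outside)
      qed
      have "c * T \<Psi> g = (\<Sum>a\<in>UNIV. F a *
          scalar_prod (left_transl lamplighter a \<Phi>) (left_transl lamplighter g \<Phi>))"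
        using \<open>c \<noteq> 0\<close>
        by (simp add: T_def \<Psi>_def scalar_prod_fscale_left scalar_prod_sum_left)
      also have "\<dots> = (\<Sum>h\<in>UNIV. F (g \<otimes>\<^bsub>lamplighter\<^esub> h) *
          scalar_prod (left_transl lamplighter (g \<otimes>\<^bsub>lamplighter\<^esub> h) \<Phi>) (left_transl lamplighter g \<Phi>))"
        by (rule sum.reindex_bij_witness[of _ "\<lambda>h. g \<otimes>\<^bsub>lamplighter\<^esub> h"
              "\<lambda>a. inv\<^bsub>lamplighter\<^esub> g \<otimes>\<^bsub>lamplighter\<^esub> a"])
           (simp_all del: lamplighter_one flip: lamplighter.m_assoc)
      also have "\<dots> = (\<Sum>h\<in>UNIV. F (g \<otimes>\<^bsub>lamplighter\<^esub> h) * ?s h)"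
        by (simp only: left_transl_mult[symmetric] scalar_prod_left_transl)
      also have "\<dots> = c * F g"
        by (simp add: s c_def sum.If_cases)
      finally show ?thesis
        using \<open>c \<noteq> 0\<close> by simp
    qed
    ultimately show ?thesis by (intro bexI[of _ \<Psi>]) (rule ext)
  qed
  have "T (left_transl lamplighter a \<Psi>) = left_transl lamplighter a (T \<Psi>)" for a \<Psi>
  proof
    fix g
    have "g = a \<otimes>\<^bsub>lamplighter\<^esub> (inv\<^bsub>lamplighter\<^esub> a \<otimes>\<^bsub>lamplighter\<^esub> g)"
      by (simp flip: lamplighter.m_assoc)
    then have "left_transl lamplighter g \<Phi>
        = left_transl lamplighter a (left_transl lamplighter (inv\<^bsub>lamplighter\<^esub> a \<otimes>\<^bsub>lamplighter\<^esub> g) \<Phi>)"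
      by (metis left_transl_mult)
    then show "T (left_transl lamplighter a \<Psi>) g = left_transl lamplighter a (T \<Psi>) g"
      unfolding T_def by (simp add: scalar_prod_left_transl) (simp add: left_transl_def)
  qed
  moreover have "bij_betw T ?U (induced_rep lamplighter ?H ?\<sigma>)"
    unfolding bij_betw_def using inj into onto by blast
  moreover have "T (f + g) = T f + T g" "T (fscale c f) = fscale c (T f)" for f g c
    by (simp_all add: T_def fun_eq_iff fscale_def[of c "T f"] scalar_prod_add_left scalar_prod_fscale_left)
  ultimately show ?thesis
    unfolding equivalent_subreps_def by blast
qed

text \<open>The average multiplies each generator by the scalar product of two lamp characters. It
  survives only if the rotation fixes \<open>\<theta>\<close>, and then the generator is a multiple
  of \<open>chi \<theta> \<otimes>\<^sub>f \<phi>\<close>.\<close>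

lemma lamp_average_ind_span:
  assumes \<phi>: "\<phi> \<in> twisted (period \<theta>) r" and "\<Psi> \<in> ind_span \<theta> (period \<theta>) \<phi>"
  shows "(\<Sum>\<alpha>\<in>UNIV. fscale (chi \<theta> \<alpha>) (left_transl lamplighter (\<alpha>, 0) \<Psi>))
           \<in> cfun.span {chi \<theta> \<otimes>\<^sub>f \<phi>}" (is "?P \<Psi> \<in> ?S")
proof -
  note in_span = assms(2)[unfolded ind_span_def]
  show ?thesis
  proof (rule additive_map_span[of ?P, OF _ _ _ _ in_span])
    show "?P (f + g) = ?P f + ?P g" for f g
      by (simp only: left_transl_add cfun.scale_right_distrib sum.distrib)
    show "?P (fscale c f) = fscale c (?P f)" for c f
      by (simp only: left_transl_fscale cfun.scale_left_commute cfun.scale_sum_right)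
    show "cfun.subspace ?S" by simp
    fix f assume "f \<in> {chi (shift (of_nat s) \<theta>) \<otimes>\<^sub>f shift (of_nat s) \<phi> | s. s < period \<theta>}"
    then obtain k where f: "f = chi (shift k \<theta>) \<otimes>\<^sub>f shift k \<phi>" by blast
    have "?P f = fscale (\<Sum>\<alpha>\<in>UNIV. chi \<theta> \<alpha> * chi (shift k \<theta>) \<alpha>) f"
      by (simp add: f left_transl_chi_tensor cfun.scale_sum_left)
    also have "\<dots> \<in> ?S"
    proof (cases "shift k \<theta> = \<theta>")
      case True
      then have "shift k \<phi> = fscale (e_char r k) \<phi>"
        using \<phi> by (simp add: twisted_def shift_eq_self_iff_cyc)
      then have "f = fscale (e_char r k) (chi \<theta> \<otimes>\<^sub>f \<phi>)"
        by (simp add: f True tensor_fscale)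
      then show ?thesis
        by (simp only:) (intro cfun.span_scale cfun.span_base singletonI)
    next
      case False
      then show ?thesis
        using chi_orthogonal[of \<theta> "shift k \<theta>"] by (simp add: cfun.span_zero)
    qed
    finally show "?P f \<in> ?S" .
  qed
qed

text \<open>Averaging a vector against \<open>\<chi>\<^sub>\<theta>\<close> over the lamp group projects onto the line of the
  generator, so a nonzero subrepresentation contains that generator.\<close>

lemma irreducible_ind_span:
  fixes \<theta> :: "'n::nontriv mod_ring \<Rightarrow> bit"
  assumes \<phi>: "\<phi> \<in> twisted (period \<theta>) r" and "\<phi> \<noteq> 0"
  shows "irreducible_subrep lamplighter (ind_span \<theta> (period \<theta>) \<phi>)" (is "irreducible_subrep _ ?U")
proof -
  define \<Phi> where "\<Phi> = chi \<theta> \<otimes>\<^sub>f \<phi>"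
  have \<Phi>U: "\<Phi> \<in> ?U"
    unfolding \<Phi>_def using \<phi> by (rule tensor_mem_ind_span)
  have "\<Phi> \<noteq> 0"
    using \<open>\<phi> \<noteq> 0\<close> by (simp add: \<Phi>_def)
  have "V = ?U" if V: "subrep lamplighter V" "V \<subseteq> ?U" "V \<noteq> {0}" for V
  proof
    have Vsub: "cfun.subspace V" and Vtr: "\<And>a f. f \<in> V \<Longrightarrow> left_transl lamplighter a f \<in> V"
      using V(1) by (auto simp only: subrep_def lamplighter_carrier UNIV_I)
    obtain u where u: "u \<in> V" "u \<noteq> 0"
      using V(3) cfun.subspace_0[OF Vsub] by blast
    then obtain g where g: "scalar_prod u (left_transl lamplighter g \<Phi>) \<noteq> 0"
      using ind_span_eq_0 V(2) unfolding \<Phi>_def by blast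
    \<comment> \<open>Translating back by \<open>g\<close> yields a vector of \<open>V\<close> that
      is not orthogonal to \<open>\<Phi>\<close> itself, since translations preserve the scalar
      product.\<close>
    define v where "v = left_transl lamplighter (inv\<^bsub>lamplighter\<^esub> g) u"
    have "scalar_prod v \<Phi> = scalar_prod (left_transl lamplighter g v) (left_transl lamplighter g \<Phi>)"
      by (simp only: scalar_prod_left_transl)
    also have "left_transl lamplighter g v = u"
      using left_transl_mult[of g "inv\<^bsub>lamplighter\<^esub> g" u]
      by (simp only: v_def) (simp add: lamplighter.r_inv del: split_paired_All)
    finally have v: "v \<in> V" "scalar_prod v \<Phi> \<noteq> 0"
      using g u(1) Vtr by (simp_all add: v_def)
    define w where "w = (\<Sum>\<alpha>\<in>UNIV. fscale (chi \<theta> \<alpha>) (left_transl lamplighter (\<alpha>, 0) v))"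
    \<comment> \<open>Every term of the average therefore has the same scalar product with
      \<open>\<Phi>\<close> as \<open>v\<close> does, so nothing cancels and \<open>w\<close> is a
      nonzero multiple of \<open>\<Phi>\<close>.\<close>
    have "scalar_prod (left_transl lamplighter (\<alpha>, 0) v) \<Phi> = chi \<theta> \<alpha> * scalar_prod v \<Phi>" for \<alpha>
    proof -
      have "\<Phi> = fscale (chi \<theta> \<alpha>) (left_transl lamplighter (\<alpha>, 0) \<Phi>)"
        by (simp add: \<Phi>_def left_transl_chi_tensor)
      then show ?thesis
        by (metis scalar_prod_fscale_right scalar_prod_left_transl cnj_chi)
    qed
    then have "scalar_prod w \<Phi> = (\<Sum>\<alpha>\<in>(UNIV :: ('n mod_ring \<Rightarrow> bit) set). scalar_prod v \<Phi>)"
      by (simp add: w_def scalar_prod_sum_left scalar_prod_fscale_left flip: mult.assoc)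
    then have "scalar_prod w \<Phi> \<noteq> 0"
      using v(2) by simp
    moreover obtain c where c: "w = fscale c \<Phi>"
      using lamp_average_ind_span[OF \<phi>, of v] v(1) V(2)
      unfolding w_def \<Phi>_def cfun.span_singleton by blast
    ultimately have "c \<noteq> 0"
      by (auto simp: scalar_prod_fscale_left)
    then have "\<Phi> = fscale (1 / c) w"
      by (simp add: c)
    moreover have "w \<in> V"
      unfolding w_def by (intro cfun.subspace_sum cfun.subspace_scale Vsub Vtr v)
    ultimately have "\<Phi> \<in> V"
      by (simp only: cfun.subspace_scale[OF Vsub])
    then show "?U \<subseteq> V"
      unfolding ind_span_def
      using Vtr by (intro cfun.span_minimal Vsub) (auto simp: \<Phi>_def simp flip: left_transl_tensor_shift)
  qed (fact V(2))
  then show ?thesis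
    using subrep_ind_span[OF \<phi>] \<Phi>U \<open>\<Phi> \<noteq> 0\<close> unfolding irreducible_subrep_def by blast
qed

text \<open>Both spaces are compared inside the common model \<open>R\<close>: \<open>w\<close> is
  the vector of \<open>W\<close> with the same image as \<open>u\<close>. One \<open>w\<close>
  inherits all eigenvalue equations of \<open>u\<close> simultaneously.\<close>

lemma equivalent_subreps_transfer_eigenvector:
  assumes U: "subrep G U" "equivalent_subreps G U R"
    and W: "subrep G W" "equivalent_subreps G W R"
    and u: "u \<in> U" "u \<noteq> 0"
  obtains w where "w \<in> W" "w \<noteq> 0"
    "\<And>a c. a \<in> carrier G \<Longrightarrow> left_transl G a u = fscale c u \<Longrightarrow> left_transl G a w = fscale c w"
proof -
  obtain S where S: "bij_betw S U R" "\<And>c f. f \<in> U \<Longrightarrow> S (fscale c f) = fscale c (S f)"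
    "\<And>a f. a \<in> carrier G \<Longrightarrow> f \<in> U \<Longrightarrow> S (left_transl G a f) = left_transl G a (S f)"
    using U(2) unfolding equivalent_subreps_def by metis
  obtain T where T: "bij_betw T W R" "\<And>c f. f \<in> W \<Longrightarrow> T (fscale c f) = fscale c (T f)"
    "\<And>a f. a \<in> carrier G \<Longrightarrow> f \<in> W \<Longrightarrow> T (left_transl G a f) = left_transl G a (T f)"
    using W(2) unfolding equivalent_subreps_def by metis
  have "S u \<in> R"
    using S(1) u(1) by (metis bij_betwE)
  then obtain w where w: "w \<in> W" "T w = S u"
    using T(1) by (metis bij_betw_imp_surj_on imageE)
  have Uz: "0 \<in> U" and Wsub: "cfun.subspace W"
    using U(1) W(1) cfun.subspace_0 unfolding subrep_def by blast+
  have "w \<noteq> 0"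
  proof
    assume "w = 0"
    \<comment> \<open>Homogeneity with the scalar 0 identifies the image of \<open>u\<close> with
      that of 0, against injectivity of \<open>S\<close>.\<close>
    then have "S u = fscale 0 (S u)"
      using T(2)[OF w(1), of 0] w(2) by simp
    also have "\<dots> = S 0"
      using S(2)[OF u(1), of 0] by simp
    finally show False
      using S(1) u Uz by (metis bij_betw_imp_inj_on inj_onD)
  qed
  moreover have "left_transl G a w = fscale c w"
    if a: "a \<in> carrier G" "left_transl G a u = fscale c u" for a c
  proof (rule inj_onD)
    show "inj_on T W" using T(1) by (rule bij_betw_imp_inj_on)
    show "T (left_transl G a w) = T (fscale c w)"
      using S(2,3) T(2,3) w u a by metis
    show "left_transl G a w \<in> W"
      using W(1) w(1) a(1) unfolding subrep_def by blast
    show "fscale c w \<in> W"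
      using Wsub w(1) by (rule cfun.subspace_scale)
  qed
  ultimately show thesis using w(1) that by blast
qed

text \<open>Pure lamp elements recover \<open>w\<close> from its values at the zero configuration,
  whence the choice of \<open>\<psi>\<close>; pure rotations in the subgroup make this slice
  twisted.\<close>

lemma induced_character_vector:
  fixes w :: "('n::nontriv mod_ring \<Rightarrow> bit) \<times> 'n mod_ring \<Rightarrow> complex"
  assumes "\<And>h. h \<in> sub_lamplighter t \<Longrightarrow>
    left_transl lamplighter h w = fscale ((chi \<theta> \<otimes>\<^sub>f e_char r) h) w"
  obtains \<psi> where "\<psi> \<in> twisted t r" "w = chi \<theta> \<otimes>\<^sub>f \<psi>"
proof
  define \<psi> where "\<psi> x = w (0, x)" for x
  have 0: "(0 :: 'n mod_ring) \<in> cyc_subgroup t"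
    using mem_cyc_subgroupI[of 0 t] by simp
  have w: "w (\<alpha>, x) = chi \<theta> \<alpha> * w (0, x)" for \<alpha> x
    using fun_cong[OF assms[of "(\<alpha>, 0)"], of "(0, x)"] 0
    by (simp add: left_transl_lamplighter fscale_def sub_lamplighter_def)
  show "w = chi \<theta> \<otimes>\<^sub>f \<psi>"
    by (rule ext, clarify) (simp only: tensor_apply \<psi>_def, rule w)
  have "w (0, x - k) = e_char r k * w (0, x)" if "k \<in> cyc_subgroup t" for k x
    using fun_cong[OF assms[of "(0, k)"], of "(0, x)"] that
    by (simp add: left_transl_lamplighter fscale_def sub_lamplighter_def)
  then show "\<psi> \<in> twisted t r"
    by (simp add: twisted_def \<psi>_def shift_def fscale_def)
qed

subsection \<open>Sums of orthogonal subrepresentations\<close>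

lemma left_transl_sum:
  "left_transl G a (\<Sum>i\<in>I. f i) = (\<Sum>i\<in>I. left_transl G a (f i))"
  by (simp add: left_transl_def fun_eq_iff sum_fun_apply)

lemma subrep_sums:
  assumes "\<And>i. i \<in> I \<Longrightarrow> subrep G (W i)"
  shows "subrep G {\<Sum>i\<in>I. v i | v. \<forall>i\<in>I. v i \<in> W i}" (is "subrep G ?V")
proof -
  have W: "cfun.subspace (W i)" "a \<in> carrier G \<Longrightarrow> f \<in> W i \<Longrightarrow> left_transl G a f \<in> W i"
    if "i \<in> I" for i a f
    using assms[OF that] by (simp_all add: subrep_def)
  have memI: "(\<Sum>i\<in>I. v i) \<in> ?V" if "\<And>i. i \<in> I \<Longrightarrow> v i \<in> W i" for v
    using that by blast
  have "cfun.subspace ?V"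
  proof (rule cfun.subspaceI)
    show "0 \<in> ?V"
      using memI[of "\<lambda>_. 0"] W(1) by (simp add: cfun.subspace_0)
    show "x + y \<in> ?V" if xy: "x \<in> ?V" "y \<in> ?V" for x y
    proof -
      obtain v v' where "\<forall>i\<in>I. v i \<in> W i \<and> v' i \<in> W i" "x = sum v I" "y = sum v' I"
        using xy by blast
      then show ?thesis
        using memI[of "\<lambda>i. v i + v' i"] by (simp add: W cfun.subspace_add sum.distrib del: plus_fun_apply)
    qed
    show "fscale c x \<in> ?V" if x: "x \<in> ?V" for c x
    proof -
      obtain v where "\<forall>i\<in>I. v i \<in> W i" "x = sum v I"
        using x by blast
      then show ?thesis
        using memI[of "\<lambda>i. fscale c (v i)"] by (simp add: W cfun.subspace_scale cfun.scale_sum_right)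
    qed
  qed
  moreover have "left_transl G a x \<in> ?V" if a: "a \<in> carrier G" and x: "x \<in> ?V" for a x
  proof -
    obtain v where "\<forall>i\<in>I. v i \<in> W i" "x = sum v I"
      using x by blast
    then show ?thesis
      using memI[of "\<lambda>i. left_transl G a (v i)"] W(2) a by (simp add: left_transl_sum)
  qed
  ultimately show ?thesis by (simp add: subrep_def)
qed

lemma mem_sums:
  assumes "finite I" "j \<in> I" "f \<in> W j" "\<And>i. i \<in> I \<Longrightarrow> cfun.subspace (W i)"
  shows "f \<in> {\<Sum>i\<in>I. v i | v. \<forall>i\<in>I. v i \<in> W i}"
proof -
  have "f = (\<Sum>i\<in>I. if i = j then f else 0)"
    using assms(1,2) by simp
  moreover have "\<forall>i\<in>I. (if i = j then f else 0) \<in> W i"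
    using assms(3,4) cfun.subspace_0 by auto
  ultimately show ?thesis by blast
qed

text \<open>Pairing the vanishing sum with \<open>v j\<close> leaves only the squared norm of
  \<open>v j\<close>.\<close>

lemma orthogonal_sum_eq_0:
  assumes "finite I" "\<And>i j. i \<in> I \<Longrightarrow> j \<in> I \<Longrightarrow> i \<noteq> j \<Longrightarrow> scalar_prod (v i) (v j) = 0"
    and "(\<Sum>i\<in>I. v i) = 0" "j \<in> I"
  shows "v j = 0"
proof -
  have "0 = (\<Sum>i\<in>I. scalar_prod (v i) (v j))"
    using assms(3) by (simp only: scalar_prod_sum_left[symmetric] scalar_prod_zero)
  also have "\<dots> = (\<Sum>i\<in>I. if i = j then scalar_prod (v j) (v j) else 0)"
    using assms by (intro sum.cong) auto
  also have "\<dots> = scalar_prod (v j) (v j)"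
    using assms by simp
  finally show ?thesis by simp
qed

text \<open>Different rotations below the period give different, hence orthogonal, lamp characters.
  Equal rotations reduce to the scalar product of \<open>\<phi>\<close> and
  \<open>\<psi>\<close>.\<close>

lemma scalar_prod_ind_span:
  assumes "scalar_prod \<phi> \<psi> = 0"
    and "f \<in> ind_span \<theta> (period \<theta>) \<phi>" "g \<in> ind_span \<theta> (period \<theta>) \<psi>"
  shows "scalar_prod f g = 0"
proof (rule orthogonal_span[OF _ assms(2,3)[unfolded ind_span_def]], clarify)
  fix s s' assume s: "s < period \<theta>" "s' < period \<theta>"
  show "scalar_prod (chi (shift (of_nat s) \<theta>) \<otimes>\<^sub>f shift (of_nat s) \<phi>)
      (chi (shift (of_nat s') \<theta>) \<otimes>\<^sub>f shift (of_nat s') \<psi>) = 0"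
  proof (cases "s = s'")
    case True
    then show ?thesis by (simp add: scalar_prod_tensor scalar_prod_shift assms(1))
  next
    case False
    then have "shift (of_nat s) \<theta> \<noteq> shift (of_nat s') \<theta>"
      using s shift_inj_below_period by blast
    then show ?thesis by (simp add: scalar_prod_tensor scalar_prod_chi)
  qed
qed

section \<open>Decomposition of the isotypic component into eigenspaces of the walk\<close>

theorem proposition8p2:
  fixes \<Theta> :: "('n::nontriv mod_ring \<Rightarrow> bit) set"
    and \<theta> :: "'n mod_ring \<Rightarrow> bit"
    and t m r :: nat
    and \<phi> :: "nat \<Rightarrow> 'n mod_ring \<Rightarrow> complex"
  assumes "CARD('n) \<ge> 3"
    and "orbit_representatives \<Theta>"
    and "\<forall>\<eta>\<in>\<Theta>. \<eta> \<noteq> 0 \<longrightarrow> \<eta> (-1) = 1"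
    and "\<theta> \<in> \<Theta>"
    and "t = period \<theta>"
    and "m = CARD('n) div t"
    and "0 \<le> r" and "r < m"
    and "orthogonal_basis \<phi> t (cfun.span (f_fun t r ` {..<t}))"
    and "\<forall>j<t. eigenvector (M_op \<theta>) (\<phi> j)"
  shows "(\<forall>j<t. subrep lamplighter (ind_span \<theta> t (\<phi> j)) \<and>
            (\<exists>c. \<forall>\<Phi>\<in>ind_span \<theta> t (\<phi> j). edge_markov \<Phi> = fscale c \<Phi>)) \<and>
         internal_direct_sum (\<lambda>j. ind_span \<theta> t (\<phi> j)) {..<t}
           (isotypic_component lamplighter
             (induced_rep lamplighter (sub_lamplighter t) (chi \<theta> \<otimes>\<^sub>f e_char r)))"
proof -
  let ?U = "\<lambda>j. ind_span \<theta> t (\<phi> j)"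
  let ?\<sigma> = "chi \<theta> \<otimes>\<^sub>f e_char r :: ('n mod_ring \<Rightarrow> bit) \<times> 'n mod_ring \<Rightarrow> complex"
  let ?R = "induced_rep lamplighter (sub_lamplighter t) ?\<sigma>"
  let ?D = "{\<Sum>j<t. v j | v. \<forall>j\<in>{..<t}. v j \<in> ?U j}"
  note t = \<open>t = period \<theta>\<close>
  have span: "cfun.span (\<phi> ` {..<t}) = twisted t r"
    using assms(6,8,9) span_f_fun[of t r, where ?'n = 'n] period_dvd_card[of \<theta>] period_pos[of \<theta>]
    by (simp add: orthogonal_basis_def t)
  have \<phi>: "\<phi> j \<in> twisted (period \<theta>) r" "\<phi> j \<noteq> 0" if "j < t" for j
    using that span cfun.span_base[of "\<phi> j" "\<phi> ` {..<t}"] assms(10) t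
    by (auto simp: eigenvector_def)
  have sub: "subrep lamplighter (?U j)" if "j < t" for j
    using subrep_ind_span[OF \<phi>(1)[OF that]] by (simp add: t)
  have eq: "equivalent_subreps lamplighter (?U j) ?R" if "j < t" for j
    using equivalent_ind_span_induced_rep[OF \<phi>[OF that]] by (simp add: t)
  have D: "subrep lamplighter ?D"
    using subrep_sums[of "{..<t}" lamplighter ?U] sub by simp
  then have Dsub: "cfun.subspace ?D"
    by (simp add: subrep_def)

  have isotypic: "isotypic_component lamplighter ?R = ?D"
  proof
    show "?D \<subseteq> isotypic_component lamplighter ?R"
    proof
      fix x assume "x \<in> ?D"
      then obtain v where v: "\<forall>j\<in>{..<t}. v j \<in> ?U j" "x = (\<Sum>j<t. v j)" by blast
      have "irreducible_subrep lamplighter (?U j)" if "j < t" for j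
        using irreducible_ind_span[OF \<phi>[OF that]] by (simp add: t)
      then have "v j \<in> isotypic_component lamplighter ?R" if "j < t" for j
        using that v(1) eq unfolding isotypic_component_def by (intro cfun.span_base) blast
      then show "x \<in> isotypic_component lamplighter ?R"
        unfolding v(2) isotypic_component_def by (intro cfun.span_sum) simp
    qed
    have "W \<subseteq> ?D" if W: "irreducible_subrep lamplighter W" "equivalent_subreps lamplighter W ?R" for W
    proof -
      \<comment> \<open>Any summand can serve as a concrete copy of \<open>?R\<close> from which an
        eigenvector is carried to \<open>W\<close>; positivity of the period makes index 0
        available.\<close>
      have 0: "0 < t" by (simp add: t period_pos)
      have "chi \<theta> \<otimes>\<^sub>f \<phi> 0 \<noteq> 0"
        using \<phi>(2)[OF 0] by simp
      moreover have "chi \<theta> \<otimes>\<^sub>f \<phi> 0 \<in> ?U 0"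
        using tensor_mem_ind_span[OF \<phi>(1)[OF 0]] by (simp add: t)
      moreover have Wrep: "subrep lamplighter W"
        using W(1) by (simp add: irreducible_subrep_def)
      ultimately obtain w where w: "w \<in> W" "w \<noteq> 0"
        "\<And>a c. left_transl lamplighter a (chi \<theta> \<otimes>\<^sub>f \<phi> 0) = fscale c (chi \<theta> \<otimes>\<^sub>f \<phi> 0) \<Longrightarrow>
           left_transl lamplighter a w = fscale c w"
        using equivalent_subreps_transfer_eigenvector[OF sub[OF 0] eq[OF 0] _ W(2)]
        by (metis UNIV_I lamplighter_carrier)
      have "left_transl lamplighter h w = fscale (?\<sigma> h) w" if "h \<in> sub_lamplighter t" for h
        using w(3) left_transl_tensor_sub_lamplighter[OF \<phi>(1)[OF 0]] that t by blast
      then obtain \<psi> where \<psi>: "\<psi> \<in> twisted t r" "w = chi \<theta> \<otimes>\<^sub>f \<psi>"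
        using induced_character_vector by blast
      \<comment> \<open>Tensoring with \<open>chi \<theta>\<close> is linear, so it suffices to
        treat the basis vectors, each of which gives the generator of its own summand.\<close>
      have "chi \<theta> \<otimes>\<^sub>f \<psi> \<in> ?D"
      proof (rule additive_map_span[of "\<lambda>f. chi \<theta> \<otimes>\<^sub>f f", OF tensor_add tensor_fscale _ Dsub])
        show "\<psi> \<in> cfun.span (\<phi> ` {..<t})"
          using \<psi>(1) by (simp only: span)
        show "chi \<theta> \<otimes>\<^sub>f f \<in> ?D" if f: "f \<in> \<phi> ` {..<t}" for f
        proof -
          obtain j where j: "j < t" "f = \<phi> j" using f by blast
          then have "chi \<theta> \<otimes>\<^sub>f f \<in> ?U j"
            using tensor_mem_ind_span[OF \<phi>(1)[OF j(1)]] by (simp add: t)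
          then show ?thesis
            using j(1) by (intro mem_sums[where j = j]) (auto simp: ind_span_def)
        qed
      qed
      then have "w \<in> W \<inter> ?D" using w(1) \<psi>(2) by blast
      \<comment> \<open>The intersection is a subrepresentation of \<open>W\<close> containing the
        nonzero \<open>w\<close>, so irreducibility makes it all of \<open>W\<close>.\<close>
      moreover have "subrep lamplighter (W \<inter> ?D)"
        using Wrep D unfolding subrep_def by (auto intro: cfun.subspace_inter)
      ultimately show ?thesis
        using W(1) w(2) unfolding irreducible_subrep_def by blast
    qed
    then show "isotypic_component lamplighter ?R \<subseteq> ?D"
      unfolding isotypic_component_def by (intro cfun.span_minimal Dsub) blast
  qed

  have "v j = 0" if v: "\<forall>i\<in>{..<t}. v i \<in> ?U i" "(\<Sum>i<t. v i) = 0" and "j \<in> {..<t}" for v j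
  proof (rule orthogonal_sum_eq_0[OF finite_lessThan _ v(2) \<open>j \<in> {..<t}\<close>])
    fix i j assume ij: "i \<in> {..<t}" "j \<in> {..<t}" "i \<noteq> j"
    then have "scalar_prod (\<phi> i) (\<phi> j) = 0"
      using assms(9) by (simp add: orthogonal_basis_def)
    then show "scalar_prod (v i) (v j) = 0"
      using v(1) ij unfolding t by (blast intro: scalar_prod_ind_span)
  qed
  then have "internal_direct_sum ?U {..<t} (isotypic_component lamplighter ?R)"
    unfolding internal_direct_sum_def isotypic by blast
  moreover have "\<exists>c. \<forall>\<Phi>\<in>?U j. edge_markov \<Phi> = fscale c \<Phi>" if "j < t" for j
    using assms(10) that edge_markov_ind_span unfolding eigenvector_def by blast
  ultimately show ?thesis
    using sub by blast
qed

end
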